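(* There exist $C^{1+\alpha}$ iterated function systems $\Phi$ with finitely many branches (for some $\alpha\in(0,1]$) such that the attractor of $\Phi$ supports an equilibrium state $\mu$ with power Fourier decay, i.e. $|\widehat\mu(\xi)|\lesssim|\xi|^{-\beta}$ for some $\beta>0$, and such that $\Phi$ is not $C^1$-conjugate to a linear iterated function system.
   Context: A $C^{1+\alpha}$ iterated function system with finitely many branches is a finite family $\Phi=\{g_a\}_{a\in\mathcal A}$ of uniformly contracting $C^{1+\alpha}$-diffeomorphisms of a compact interval into itself (onto their images); its attractor $F$ is the unique non-empty compact set with $F=\bigcup_a g_a(F)$, with coding map $\pi:\mathcal A^{\mathbb N}\to F$. An equilibrium state is the projection under $\pi$ of the shift-invariant equilibrium (Gibbs) measure on $\mathcal A^{\mathbb N}$ of a Hölder potential. $\Phi$ is $C^1$-conjugate to a linear IFS if there is a $C^1$ diffeomorphism $h$ onto its image such that $\{hgh^{-1}:g\in\Phi\}$ consists of maps with constant derivative. $\widehat\mu(\xi)=\int e^{-2\pi i\xi x}d\mu(x)$. *)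

theory Defs
  imports "HOL-Probability.Probability"
begin

section \<open>\<open>C\<^sup>1\<close> and \<open>C\<^sup>1\<^sup>+\<^sup>\<alpha>\<close> maps on subsets of the line\<close>

text \<open>Derivatives are taken within the domain, i.e. they are one-sided at the endpoints of a
  closed interval.\<close>

definition C1_on :: "real set \<Rightarrow> (real \<Rightarrow> real) \<Rightarrow> bool" where
  "C1_on S f \<longleftrightarrow> (\<exists>f'. (\<forall>x\<in>S. (f has_real_derivative f' x) (at x within S)) \<and> continuous_on S f')"

definition C1_holder_on :: "real \<Rightarrow> real set \<Rightarrow> (real \<Rightarrow> real) \<Rightarrow> bool" where
  "C1_holder_on \<alpha> S f \<longleftrightarrow> (\<exists>f' K. (\<forall>x\<in>S. (f has_real_derivative f' x) (at x within S)) \<and>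
     (\<forall>x\<in>S. \<forall>y\<in>S. \<bar>f' x - f' y\<bar> \<le> K * \<bar>x - y\<bar> powr \<alpha>))"

definition C1_diffeo_on :: "real set \<Rightarrow> (real \<Rightarrow> real) \<Rightarrow> bool" where
  "C1_diffeo_on S f \<longleftrightarrow> inj_on f S \<and> C1_on S f \<and> C1_on (f ` S) (the_inv_into S f)"

definition C1_holder_diffeo_on :: "real \<Rightarrow> real set \<Rightarrow> (real \<Rightarrow> real) \<Rightarrow> bool" where
  "C1_holder_diffeo_on \<alpha> S f \<longleftrightarrow>
     inj_on f S \<and> C1_holder_on \<alpha> S f \<and> C1_holder_on \<alpha> (f ` S) (the_inv_into S f)"


section \<open>Iterated function systems\<close>

text \<open>A system is a family \<open>g\<close> indexed by an alphabet \<open>A\<close>. Only the values of \<open>g a\<close>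
  (\<open>a \<in> A\<close>) on the interval \<open>{c..d}\<close> matter.\<close>

definition C1_holder_ifs ::
    "real \<Rightarrow> real \<Rightarrow> real \<Rightarrow> 'a set \<Rightarrow> ('a \<Rightarrow> real \<Rightarrow> real) \<Rightarrow> bool" where
  "C1_holder_ifs \<alpha> c d A g \<longleftrightarrow>
     c < d \<and> finite A \<and> A \<noteq> {} \<and>
     (\<forall>a\<in>A. g a ` {c..d} \<subseteq> {c..d} \<and> C1_holder_diffeo_on \<alpha> {c..d} (g a)) \<and>
     (\<exists>\<rho><1. \<forall>a\<in>A. \<rho>-lipschitz_on {c..d} (g a))"

text \<open>By Hutchinson's theorem there is exactly one such \<open>F\<close> for each system.\<close>

definition is_attractor ::
    "real \<Rightarrow> real \<Rightarrow> 'a set \<Rightarrow> ('a \<Rightarrow> real \<Rightarrow> real) \<Rightarrow> real set \<Rightarrow> bool" where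
  "is_attractor c d A g F \<longleftrightarrow>
     F \<noteq> {} \<and> compact F \<and> F \<subseteq> {c..d} \<and> F = (\<Union>a\<in>A. g a ` F)"

text \<open>\<open>prefix_map g \<omega> n = g (\<omega> 0) \<circ> \<dots> \<circ> g (\<omega> (n - 1))\<close>.\<close>

primrec prefix_map :: "('a \<Rightarrow> real \<Rightarrow> real) \<Rightarrow> (nat \<Rightarrow> 'a) \<Rightarrow> nat \<Rightarrow> real \<Rightarrow> real" where
  "prefix_map g \<omega> 0 = id"
| "prefix_map g \<omega> (Suc n) = prefix_map g \<omega> n \<circ> g (\<omega> n)"

text \<open>The sets intersected are nested compact intervals whose lengths tend to \<open>0\<close>, so for a
  sequence \<open>\<omega>\<close> over the alphabet the intersection is a singleton.\<close>

definition coding_map ::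
    "real \<Rightarrow> real \<Rightarrow> ('a \<Rightarrow> real \<Rightarrow> real) \<Rightarrow> (nat \<Rightarrow> 'a) \<Rightarrow> real" where
  "coding_map c d g \<omega> = the_elem (\<Inter>n. prefix_map g \<omega> n ` {c..d})"

definition C1_conjugate_to_linear ::
    "real \<Rightarrow> real \<Rightarrow> 'a set \<Rightarrow> ('a \<Rightarrow> real \<Rightarrow> real) \<Rightarrow> bool" where
  "C1_conjugate_to_linear c d A g \<longleftrightarrow>
     (\<exists>h. C1_diffeo_on {c..d} h \<and>
       (\<forall>a\<in>A. \<exists>r. \<forall>y \<in> h ` {c..d}.
          (h \<circ> g a \<circ> the_inv_into {c..d} h has_real_derivative r) (at y within h ` {c..d})))"


section \<open>Equilibrium states\<close>

definition shift_space :: "'a set \<Rightarrow> (nat \<Rightarrow> 'a) measure" where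
  "shift_space A = (\<Pi>\<^sub>M i\<in>(UNIV :: nat set). count_space A)"

definition shift :: "(nat \<Rightarrow> 'a) \<Rightarrow> (nat \<Rightarrow> 'a)" where
  "shift \<omega> = (\<lambda>n. \<omega> (Suc n))"

definition invariant_prob :: "'a set \<Rightarrow> (nat \<Rightarrow> 'a) measure \<Rightarrow> bool" where
  "invariant_prob A m \<longleftrightarrow>
     prob_space m \<and> sets m = sets (shift_space A) \<and> distr m m shift = m"

text \<open>Hoelder continuity with respect to the metrics \<open>\<theta> ^ min {i. \<omega> i \<noteq> \<tau> i}\<close>.\<close>

definition holder_potential :: "'a set \<Rightarrow> ((nat \<Rightarrow> 'a) \<Rightarrow> real) \<Rightarrow> bool" where
  "holder_potential A \<phi> \<longleftrightarrow>
     (\<exists>K \<theta>. 0 < \<theta> \<and> \<theta> < 1 \<and>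
       (\<forall>\<omega> \<in> space (shift_space A). \<forall>\<tau> \<in> space (shift_space A). \<forall>n.
          (\<forall>i<n. \<omega> i = \<tau> i) \<longrightarrow> \<bar>\<phi> \<omega> - \<phi> \<tau>\<bar> \<le> K * \<theta> ^ n))"

definition cylinder :: "'a set \<Rightarrow> (nat \<Rightarrow> 'a) \<Rightarrow> nat \<Rightarrow> (nat \<Rightarrow> 'a) set" where
  "cylinder A w n = {\<tau> \<in> space (shift_space A). \<forall>i<n. \<tau> i = w i}"

definition cylinder_entropy :: "'a set \<Rightarrow> (nat \<Rightarrow> 'a) measure \<Rightarrow> nat \<Rightarrow> real" where
  "cylinder_entropy A m n =
     - (\<Sum>w \<in> {..<n} \<rightarrow>\<^sub>E A. measure m (cylinder A w n) * ln (measure m (cylinder A w n)))"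

text \<open>Entropy of an invariant measure on the full shift, computed on the partition into
  1-cylinders (a generator). For invariant \<open>m\<close> the sequence converges, by subadditivity; the
  upper limit just gives a total definition of its limit.\<close>

definition shift_entropy :: "'a set \<Rightarrow> (nat \<Rightarrow> 'a) measure \<Rightarrow> ereal" where
  "shift_entropy A m = limsup (\<lambda>n. ereal (cylinder_entropy A m n / real n))"

definition equilibrium_measure ::
    "'a set \<Rightarrow> ((nat \<Rightarrow> 'a) \<Rightarrow> real) \<Rightarrow> (nat \<Rightarrow> 'a) measure \<Rightarrow> bool" where
  "equilibrium_measure A \<phi> m \<longleftrightarrow>
     invariant_prob A m \<and>
     (\<forall>\<nu>. invariant_prob A \<nu> \<longrightarrow>
        shift_entropy A \<nu> + ereal (\<integral>\<omega>. \<phi> \<omega> \<partial>\<nu>) \<le> shift_entropy A m + ereal (\<integral>\<omega>. \<phi> \<omega> \<partial>m))"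

text \<open>Bowen's Gibbs property; the constant \<open>P\<close> is necessarily the topological pressure of \<open>\<phi>\<close>.\<close>

definition gibbs_measure ::
    "'a set \<Rightarrow> ((nat \<Rightarrow> 'a) \<Rightarrow> real) \<Rightarrow> (nat \<Rightarrow> 'a) measure \<Rightarrow> bool" where
  "gibbs_measure A \<phi> m \<longleftrightarrow>
     invariant_prob A m \<and>
     (\<exists>P C. C > 0 \<and> (\<forall>\<omega> \<in> space (shift_space A). \<forall>n.
        exp ((\<Sum>k<n. \<phi> ((shift ^^ k) \<omega>)) - real n * P) / C \<le> measure m (cylinder A \<omega> n) \<and>
        measure m (cylinder A \<omega> n) \<le> C * exp ((\<Sum>k<n. \<phi> ((shift ^^ k) \<omega>)) - real n * P)))"

text \<open>For a Hoelder potential on a full shift over a finite alphabet, the equilibrium measure and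
  the invariant Gibbs measure exist, are unique and coincide; both properties are required here.\<close>

definition equilibrium_state ::
    "real \<Rightarrow> real \<Rightarrow> 'a set \<Rightarrow> ('a \<Rightarrow> real \<Rightarrow> real) \<Rightarrow> real measure \<Rightarrow> bool" where
  "equilibrium_state c d A g \<mu> \<longleftrightarrow>
     (\<exists>\<phi> m. holder_potential A \<phi> \<and> equilibrium_measure A \<phi> m \<and> gibbs_measure A \<phi> m \<and>
        \<mu> = distr m borel (coding_map c d g))"


section \<open>Fourier decay\<close>

definition fourier_transform :: "real measure \<Rightarrow> real \<Rightarrow> complex" where
  "fourier_transform \<mu> \<xi> = (\<integral>x. exp (- 2 * of_real pi * \<i> * of_real \<xi> * of_real x) \<partial>\<mu>)"

definition power_fourier_decay :: "real measure \<Rightarrow> bool" where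
  "power_fourier_decay \<mu> \<longleftrightarrow>
     (\<exists>\<beta>>0. \<exists>C. \<forall>\<xi>. \<xi> \<noteq> 0 \<longrightarrow> norm (fourier_transform \<mu> \<xi>) \<le> C * \<bar>\<xi>\<bar> powr (- \<beta>))"

end

theory Submission
  imports Defs
begin

text \<open>A linear system may have Lebesgue measure as stationary measure, and Lebesgue measure on an
  interval has Fourier decay of order one. The idea is to keep the measure and destroy the linearity.

  Two branches \<open>g\<^sub>0, g\<^sub>1\<close> onto the same interval \<open>[0, 1/2]\<close> push Lebesgue measure forward to measures
  whose densities are \<open>(g\<^sub>0\<inverse>)'\<close> and \<open>(g\<^sub>1\<inverse>)'\<close>. If the sum of these is the constant \<open>4\<close>, then
  the two branches together, with their translates by \<open>1/2\<close>, average Lebesgue measure to itself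
  although no branch is affine. The inverse branches are taken to be \<open>3/2 u + u\<^sup>2\<close> and
  \<open>5/2 u - u\<^sup>2\<close>; they give four uniformly contracting analytic maps of \<open>[0, 1]\<close> with attractor
  \<open>[0, 1]\<close> (\<open>branches_stationary\<close>).

  All four branches have weight \<open>1/4\<close>, so the symbolic measure is the uniform Bernoulli measure. It is
  the measure of maximal entropy, i.e. the equilibrium and Gibbs measure of the zero potential. Its
  projection under the coding map is the unique stationary measure, hence Lebesgue measure
  (\<open>integral_coding_map\<close>).

  The system is not linearisable: \<open>g\<^sub>0\<close> and \<open>g\<^sub>1\<close> agree at \<open>0\<close> and at \<open>1\<close>. After a linearising change
  of coordinates they would be affine maps that agree at two points, hence equal, but \<open>g\<^sub>0 \<noteq> g\<^sub>1\<close>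
  (\<open>not_C1_conjugate_to_linear\<close>).\<close>

section \<open>Cylinders and entropy on the full shift\<close>

lemma space_shift_space: "space (shift_space A) = {\<omega>. \<forall>i. \<omega> i \<in> A}"
  by (auto simp: shift_space_def space_PiM PiE_def)

lemma coordinate_measurable: "(\<lambda>\<omega>. \<omega> i) \<in> measurable (shift_space A) (count_space A)"
  unfolding shift_space_def by (rule measurable_component_singleton) simp

lemma shift_measurable: "shift \<in> measurable (shift_space A) (shift_space A)"
  unfolding shift_def shift_space_def
  by (rule measurable_PiM_single') (auto simp: space_PiM PiE_def)

lemma cylinder_sets:
  assumes "\<And>i. i < n \<Longrightarrow> w i \<in> A"
  shows "cylinder A w n \<in> sets (shift_space A)"
proof -
  have "cylinder A w n = {\<tau> \<in> space (shift_space A). \<forall>i\<in>{..<n}. \<tau> i \<in> {w i}}"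
    by (auto simp: cylinder_def)
  also have "\<dots> \<in> sets (shift_space A)"
  proof (rule sets.sets_Collect_finite_All)
    fix i assume "i \<in> {..<n}"
    then have "{w i} \<in> sets (count_space A)" using assms by auto
    from measurable_sets[OF coordinate_measurable this]
    show "{\<tau> \<in> space (shift_space A). \<tau> i \<in> {w i}} \<in> sets (shift_space A)"
      by (simp add: vimage_def Int_def conj_commute)
  qed auto
  finally show ?thesis .
qed

lemma sum_measure_cylinders:
  fixes A :: "'a set"
  assumes "finite A" "prob_space m" and sets: "sets m = sets (shift_space A)"
  shows "(\<Sum>w \<in> {..<n} \<rightarrow>\<^sub>E A. measure m (cylinder A w n)) = 1"
proof -
  interpret prob_space m by fact
  let ?W = "{..<n} \<rightarrow>\<^sub>E A"
  have fin: "finite ?W" using assms(1) by (simp add: finite_PiE)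
  have "(\<Sum>w \<in> ?W. prob (cylinder A w n)) = prob (\<Union>w\<in>?W. cylinder A w n)"
  proof (rule finite_measure_finite_Union[symmetric])
    show "finite ?W" by (rule fin)
    show "(\<lambda>w. cylinder A w n) ` ?W \<subseteq> events"
      unfolding sets by (auto intro!: cylinder_sets)
    show "disjoint_family_on (\<lambda>w. cylinder A w n) ?W"
      unfolding disjoint_family_on_def
    proof (intro ballI impI)
      fix v w assume v: "v \<in> ?W" and w: "w \<in> ?W" and "v \<noteq> w"
      show "cylinder A v n \<inter> cylinder A w n = {}"
      proof (rule ccontr)
        assume "cylinder A v n \<inter> cylinder A w n \<noteq> {}"
        then have "\<forall>i\<in>{..<n}. v i = w i" by (auto simp: cylinder_def)
        then have "v = w" using v w by (intro PiE_ext[of v _ _ w]) auto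
        with \<open>v \<noteq> w\<close> show False by simp
      qed
    qed
  qed
  also have "(\<Union>w\<in>?W. cylinder A w n) = space m"
  proof
    show "(\<Union>w\<in>?W. cylinder A w n) \<subseteq> space m"
      unfolding sets_eq_imp_space_eq[OF sets] by (auto simp: cylinder_def)
    show "space m \<subseteq> (\<Union>w\<in>?W. cylinder A w n)"
    proof
      fix \<tau> assume "\<tau> \<in> space m"
      then have \<tau>: "\<tau> \<in> space (shift_space A)" using sets_eq_imp_space_eq[OF sets] by simp
      then have "restrict \<tau> {..<n} \<in> ?W" by (auto simp: space_shift_space)
      moreover have "\<tau> \<in> cylinder A (restrict \<tau> {..<n}) n" using \<tau> by (auto simp: cylinder_def)
      ultimately show "\<tau> \<in> (\<Union>w\<in>?W. cylinder A w n)" by blast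
    qed
  qed
  finally show ?thesis by (simp add: prob_space)
qed

text \<open>This is \<open>ln t \<le> t - 1\<close> at \<open>t = 1 / (N p)\<close>. Summed over a probability vector with \<open>N\<close>
  entries it bounds the entropy by \<open>ln N\<close>, because the terms \<open>1 / N - p\<close> add up to \<open>0\<close>.\<close>

lemma neg_mult_ln_le:
  fixes p N :: real
  assumes "0 \<le> p" "0 < N"
  shows "- (p * ln p) \<le> 1 / N - p + p * ln N"
proof (cases "p = 0")
  case False
  with assms have p: "0 < p" by simp
  have "ln (1 / (N * p)) \<le> 1 / (N * p) - 1"
    using p assms by (intro ln_le_minus_one) auto
  then have "p * ln (1 / (N * p)) \<le> p * (1 / (N * p) - 1)"
    using p by (intro mult_left_mono) auto
  then show ?thesis
    using p assms by (simp add: ln_div ln_mult algebra_simps)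
qed (use assms in simp)

lemma cylinder_entropy_le:
  fixes A :: "'a set"
  assumes "finite A" "A \<noteq> {}" "prob_space m" "sets m = sets (shift_space A)"
  shows "cylinder_entropy A m n \<le> real n * ln (real (card A))"
proof -
  let ?W = "{..<n} \<rightarrow>\<^sub>E A" and ?N = "real (card A) ^ n" and ?p = "\<lambda>w. measure m (cylinder A w n)"
  have N: "0 < ?N" using assms by (simp add: card_gt_0_iff)
  have "cylinder_entropy A m n = (\<Sum>w\<in>?W. - (?p w * ln (?p w)))"
    by (simp add: cylinder_entropy_def sum_negf)
  also have "\<dots> \<le> (\<Sum>w\<in>?W. 1 / ?N - ?p w + ?p w * ln ?N)"
    using N by (intro sum_mono neg_mult_ln_le) auto
  also have "\<dots> = ln ?N"
    using sum_measure_cylinders[OF assms(1,3,4), of n] assms(1,2)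
    by (simp add: sum.distrib sum_subtractf card_PiE card_gt_0_iff flip: sum_distrib_right)
  also have "\<dots> = real n * ln (real (card A))"
    using assms by (simp add: ln_realpow card_gt_0_iff)
  finally show ?thesis .
qed

lemma shift_entropy_le:
  assumes "finite A" "A \<noteq> {}" "prob_space m" "sets m = sets (shift_space A)"
  shows "shift_entropy A m \<le> ereal (ln (real (card A)))"
  unfolding shift_entropy_def
proof (rule Limsup_bounded, rule always_eventually, rule allI)
  fix n
  have "0 \<le> ln (real (card A))" using assms by (simp add: Suc_le_eq card_gt_0_iff)
  then show "ereal (cylinder_entropy A m n / real n) \<le> ereal (ln (real (card A)))"
    using cylinder_entropy_le[OF assms, of n] by (cases "n = 0") (auto simp: divide_le_eq mult.commute)
qed

section \<open>The uniform Bernoulli measure\<close>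

definition uniform_bernoulli :: "'a set \<Rightarrow> (nat \<Rightarrow> 'a) measure" where
  "uniform_bernoulli A = (\<Pi>\<^sub>M i\<in>(UNIV :: nat set). uniform_count_measure A)"

lemma sets_uniform_bernoulli: "sets (uniform_bernoulli A) = sets (shift_space A)"
  unfolding uniform_bernoulli_def shift_space_def
  by (intro sets_PiM_cong refl sets_uniform_count_measure_count_space)

lemma space_uniform_bernoulli: "space (uniform_bernoulli A) = space (shift_space A)"
  by (rule sets_eq_imp_space_eq[OF sets_uniform_bernoulli])

lemma measurable_uniform_bernoulli:
  "measurable (uniform_bernoulli A) N = measurable (shift_space A) N"
  by (rule measurable_cong_sets[OF sets_uniform_bernoulli refl])

lemma sequence_space_uniform_count:
  assumes "finite A" "A \<noteq> {}"
  shows "sequence_space (uniform_count_measure A)"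
  unfolding sequence_space_def
  by (intro product_prob_spaceI prob_space_uniform_count_measure assms)

lemma prob_space_uniform_bernoulli:
  assumes "finite A" "A \<noteq> {}"
  shows "prob_space (uniform_bernoulli A)"
  unfolding uniform_bernoulli_def
  by (intro prob_space_PiM prob_space_uniform_count_measure assms)

lemma invariant_prob_uniform_bernoulli:
  assumes "finite A" "A \<noteq> {}"
  shows "invariant_prob A (uniform_bernoulli A)"
proof -
  have "distr (uniform_bernoulli A) (uniform_bernoulli A) shift = uniform_bernoulli A"
    using distr_PiM_reindex[of UNIV "\<lambda>i. uniform_count_measure A" Suc UNIV]
      prob_space_uniform_count_measure[OF assms]
    by (simp add: uniform_bernoulli_def shift_def[abs_def] restrict_UNIV)
  then show ?thesis
    by (simp add: invariant_prob_def sets_uniform_bernoulli prob_space_uniform_bernoulli assms)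
qed

lemma measure_uniform_bernoulli_cylinder:
  assumes A: "finite A" "A \<noteq> {}" and w: "\<And>i. i < n \<Longrightarrow> w i \<in> A"
  shows "measure (uniform_bernoulli A) (cylinder A w n) = 1 / real (card A) ^ n"
proof -
  interpret sequence_space "uniform_count_measure A"
    by (rule sequence_space_uniform_count[OF A])
  have "cylinder A w n = prod_emb UNIV (\<lambda>i. uniform_count_measure A) {..<n} (\<Pi>\<^sub>E i\<in>{..<n}. {w i})"
    by (auto simp: cylinder_def space_shift_space prod_emb_def space_uniform_count_measure PiE_iff)
  moreover have "measure S (prod_emb UNIV (\<lambda>i. uniform_count_measure A) {..<n} (\<Pi>\<^sub>E i\<in>{..<n}. {w i}))
      = (\<Prod>i<n. measure (uniform_count_measure A) {w i})"
    using w by (intro measure_PiM_emb) (auto simp: sets_uniform_count_measure)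
  ultimately have "measure (uniform_bernoulli A) (cylinder A w n)
      = (\<Prod>i<n. measure (uniform_count_measure A) {w i})"
    by (simp only: uniform_bernoulli_def)
  also have "\<dots> = (\<Prod>i<n. 1 / real (card A))"
    using A w by (intro prod.cong) (auto simp: measure_uniform_count_measure)
  finally show ?thesis by (simp add: power_divide)
qed

lemma shift_entropy_uniform_bernoulli:
  assumes A: "finite A" "A \<noteq> {}"
  shows "shift_entropy A (uniform_bernoulli A) = ereal (ln (real (card A)))"
proof -
  have N: "0 < real (card A)" using A by (simp add: card_gt_0_iff)
  have "cylinder_entropy A (uniform_bernoulli A) n = real n * ln (real (card A))" for n
  proof -
    have "cylinder_entropy A (uniform_bernoulli A) n
        = - (\<Sum>w \<in> {..<n} \<rightarrow>\<^sub>E A. 1 / real (card A) ^ n * ln (1 / real (card A) ^ n))"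
      unfolding cylinder_entropy_def
      by (intro arg_cong[where f=uminus] sum.cong refl)
         (auto simp: measure_uniform_bernoulli_cylinder[OF A] PiE_iff)
    then show ?thesis
      using A N by (simp add: card_PiE ln_div ln_realpow)
  qed
  then have *: "\<forall>\<^sub>F n in sequentially. ereal (cylinder_entropy A (uniform_bernoulli A) n / real n)
      = ereal (ln (real (card A)))"
    by (intro eventually_sequentiallyI[of 1]) auto
  then show ?thesis
    unfolding shift_entropy_def Limsup_eq[OF *] by (simp add: Limsup_const)
qed

text \<open>With zero potential only entropy counts, and no measure has more than \<open>ln (card A)\<close>.\<close>

lemma uniform_bernoulli_equilibrium:
  assumes A: "finite A" "A \<noteq> {}"
  shows "equilibrium_measure A (\<lambda>_. 0) (uniform_bernoulli A)"
  unfolding equilibrium_measure_def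
  using invariant_prob_uniform_bernoulli[OF A] shift_entropy_le[OF A]
  by (auto simp: shift_entropy_uniform_bernoulli[OF A] invariant_prob_def)

lemma uniform_bernoulli_gibbs:
  assumes A: "finite A" "A \<noteq> {}"
  shows "gibbs_measure A (\<lambda>_. 0) (uniform_bernoulli A)"
proof -
  have "exp (- (real n * ln (real (card A)))) = 1 / real (card A) ^ n" for n
    using A by (simp add: exp_minus exp_of_nat_mult card_gt_0_iff inverse_eq_divide)
  then show ?thesis
    unfolding gibbs_measure_def using invariant_prob_uniform_bernoulli[OF A]
    by (intro conjI exI[of _ "ln (real (card A))"] exI[of _ "1::real"])
      (auto simp: measure_uniform_bernoulli_cylinder[OF A] space_shift_space)
qed

text \<open>The first letter is uniform and independent of the rest, and the rest has the same law as the
  whole sequence. This is what makes expectations along random compositions recursive.\<close>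

lemma integral_uniform_bernoulli_first:
  fixes f :: "(nat \<Rightarrow> 'a) \<Rightarrow> real"
  assumes A: "finite A" "A \<noteq> {}"
    and f: "f \<in> borel_measurable (shift_space A)"
    and bound: "\<And>\<omega>. \<omega> \<in> space (shift_space A) \<Longrightarrow> \<bar>f \<omega>\<bar> \<le> B"
  shows "(\<integral>\<omega>. f \<omega> \<partial>uniform_bernoulli A)
    = (\<Sum>a\<in>A. \<integral>\<omega>. f (case_nat a \<omega>) \<partial>uniform_bernoulli A) / real (card A)"
proof -
  let ?M = "uniform_count_measure A"
  interpret sequence_space ?M
    by (rule sequence_space_uniform_count[OF A])
  have S: "S = uniform_bernoulli A" by (simp add: uniform_bernoulli_def)
  interpret PS: pair_prob_space ?M S ..
  have f': "f \<in> borel_measurable S"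
    using f by (simp add: S measurable_uniform_bernoulli)
  have m: "(\<lambda>(s, \<omega>). case_nat s \<omega>) \<in> measurable (?M \<Otimes>\<^sub>M S) S"
    by measurable
  have int: "integrable (?M \<Otimes>\<^sub>M S) (\<lambda>(s, \<omega>). f (case_nat s \<omega>))"
  proof (rule PS.integrable_const_bound[of _ B])
    have "\<bar>f (case_nat a \<omega>)\<bar> \<le> B" if "(a, \<omega>) \<in> space (?M \<Otimes>\<^sub>M S)" for a \<omega>
      using measurable_space[OF m that] bound by (simp add: S space_uniform_bernoulli)
    then show "AE p in ?M \<Otimes>\<^sub>M S. norm (case p of (s, \<omega>) \<Rightarrow> f (case_nat s \<omega>)) \<le> B"
      by (intro AE_I2) auto
    show "(\<lambda>(s, \<omega>). f (case_nat s \<omega>)) \<in> borel_measurable (?M \<Otimes>\<^sub>M S)"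
      using measurable_compose[OF m f'] by (simp add: case_prod_unfold)
  qed
  have "(\<integral>\<omega>. f \<omega> \<partial>S) = (\<integral>\<omega>. f \<omega> \<partial>distr (?M \<Otimes>\<^sub>M S) S (\<lambda>(s, \<omega>). case_nat s \<omega>))"
    by (simp add: PiM_iter)
  also have "\<dots> = (\<integral>p. (case p of (s, \<omega>) \<Rightarrow> f (case_nat s \<omega>)) \<partial>(?M \<Otimes>\<^sub>M S))"
    by (subst integral_distr[OF m f']) (simp add: case_prod_unfold)
  also have "\<dots> = (\<integral>a. \<integral>\<omega>. f (case_nat a \<omega>) \<partial>S \<partial>?M)"
    using PS.integral_fst'[OF int] by simp
  finally show ?thesis
    by (simp add: S integral_uniform_count_measure[OF A(1)])
qed


section \<open>The coding map of a contracting system\<close>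

text \<open>The composition is defined by adding maps on the inside. Splitting off the outermost map instead
  matches conditioning on the first letter.\<close>

lemma prefix_map_Suc_shift: "prefix_map g \<omega> (Suc n) = g (\<omega> 0) \<circ> prefix_map g (shift \<omega>) n"
  by (induction n) (auto simp: shift_def fun_eq_iff)

locale contracting_system =
  fixes c d :: real and A :: "'a set" and g :: "'a \<Rightarrow> real \<Rightarrow> real" and \<rho> :: real
  assumes c_le_d: "c \<le> d"
    and maps_into: "a \<in> A \<Longrightarrow> g a ` {c..d} \<subseteq> {c..d}"
    and contracting: "a \<in> A \<Longrightarrow> \<rho>-lipschitz_on {c..d} (g a)"
    and ratio_less_one: "\<rho> < 1"
begin

lemma prefix_map_into:
  assumes "\<omega> \<in> space (shift_space A)"
  shows "prefix_map g \<omega> n ` {c..d} \<subseteq> {c..d}"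
proof (induction n)
  case (Suc n)
  have "g (\<omega> n) ` {c..d} \<subseteq> {c..d}"
    using assms by (intro maps_into) (simp add: space_shift_space)
  then show ?case using Suc by fastforce
qed simp

lemma prefix_map_mem:
  "\<omega> \<in> space (shift_space A) \<Longrightarrow> x \<in> {c..d} \<Longrightarrow> prefix_map g \<omega> n x \<in> {c..d}"
  using prefix_map_into by blast

lemma prefix_map_lipschitz:
  assumes "\<omega> \<in> space (shift_space A)"
  shows "(\<rho> ^ n)-lipschitz_on {c..d} (prefix_map g \<omega> n)"
proof (induction n)
  case 0
  show ?case by (simp add: lipschitz_on_def)
next
  case (Suc n)
  have \<omega>: "\<omega> n \<in> A" using assms by (simp add: space_shift_space)
  have "(\<rho> ^ n * \<rho>)-lipschitz_on {c..d} (prefix_map g \<omega> n \<circ> g (\<omega> n))"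
    using lipschitz_on_subset[OF Suc maps_into[OF \<omega>]] contracting[OF \<omega>]
    by (rule lipschitz_on_compose[rotated])
  then show ?case by (simp add: mult.commute)
qed

lemma prefix_map_decreasing:
  assumes "\<omega> \<in> space (shift_space A)" "m \<le> n"
  shows "prefix_map g \<omega> n ` {c..d} \<subseteq> prefix_map g \<omega> m ` {c..d}"
  using assms(2)
proof (induction rule: dec_induct)
  case (step n)
  have "g (\<omega> n) ` {c..d} \<subseteq> {c..d}"
    using assms by (intro maps_into) (simp add: space_shift_space)
  then have "prefix_map g \<omega> (Suc n) ` {c..d} \<subseteq> prefix_map g \<omega> n ` {c..d}"
    by (auto simp: image_comp[symmetric])
  with step show ?case by blast
qed simp

lemma prefix_map_diameter:
  assumes "\<omega> \<in> space (shift_space A)" "u \<in> prefix_map g \<omega> n ` {c..d}" "v \<in> prefix_map g \<omega> n ` {c..d}"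
  shows "dist u v \<le> \<rho> ^ n * (d - c)"
proof -
  obtain x y where xy: "x \<in> {c..d}" "y \<in> {c..d}" "u = prefix_map g \<omega> n x" "v = prefix_map g \<omega> n y"
    using assms by auto
  then have "dist u v \<le> \<rho> ^ n * dist x y"
    using lipschitz_onD[OF prefix_map_lipschitz[OF assms(1)]] by simp
  also have "\<dots> \<le> \<rho> ^ n * (d - c)"
    using xy lipschitz_on_nonneg[OF prefix_map_lipschitz[OF assms(1), of n]]
    by (intro mult_left_mono) (auto simp: dist_real_def)
  finally show ?thesis .
qed

lemma ratio_power_tendsto:
  assumes "A \<noteq> {}"
  shows "(\<lambda>n. \<rho> ^ n * (d - c)) \<longlonglongrightarrow> 0"
proof -
  have "0 \<le> \<rho>" using assms contracting lipschitz_on_nonneg by blast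
  then show ?thesis using ratio_less_one by (intro tendsto_mult_left_zero LIMSEQ_power_zero) auto
qed

text \<open>\<open>the_elem\<close> says nothing about a set that is not a singleton. By completeness the nested closed
  intervals meet, and as their diameters tend to \<open>0\<close> they meet in one point only.\<close>

lemma coding_map_mem:
  assumes \<omega>: "\<omega> \<in> space (shift_space A)"
  shows "coding_map c d g \<omega> \<in> prefix_map g \<omega> n ` {c..d}"
proof -
  have "A \<noteq> {}" using \<omega> by (auto simp: space_shift_space)
  note lim = ratio_power_tendsto[OF this]
  have "\<exists>p. (\<Inter>n. prefix_map g \<omega> n ` {c..d}) = {p}"
  proof (rule decreasing_closed_nest_sing)
    show "closed (prefix_map g \<omega> n ` {c..d})" for n
      using lipschitz_on_continuous_on[OF prefix_map_lipschitz[OF \<omega>]]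
      by (intro compact_imp_closed compact_continuous_image) auto
    show "prefix_map g \<omega> n ` {c..d} \<noteq> {}" for n
      using c_le_d by simp
    show "prefix_map g \<omega> n ` {c..d} \<subseteq> prefix_map g \<omega> m ` {c..d}" if "m \<le> n" for m n
      using prefix_map_decreasing[OF \<omega> that] .
    show "\<exists>n. \<forall>x\<in>prefix_map g \<omega> n ` {c..d}. \<forall>y\<in>prefix_map g \<omega> n ` {c..d}. dist x y < e"
      if "0 < e" for e
    proof -
      obtain n where "\<rho> ^ n * (d - c) < e"
        using order_tendstoD(2)[OF lim \<open>0 < e\<close>] by (auto simp: eventually_sequentially)
      then show ?thesis using prefix_map_diameter[OF \<omega>, of _ n] by (meson le_less_trans)
    qed
  qed
  then obtain p where p: "(\<Inter>n. prefix_map g \<omega> n ` {c..d}) = {p}" ..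
  then have "coding_map c d g \<omega> = p" by (simp add: coding_map_def)
  with p show ?thesis by blast
qed

lemma coding_map_in_interval:
  assumes "\<omega> \<in> space (shift_space A)"
  shows "coding_map c d g \<omega> \<in> {c..d}"
  using coding_map_mem[OF assms, of 0] by simp

lemma prefix_map_tendsto_coding_map:
  assumes \<omega>: "\<omega> \<in> space (shift_space A)" and x: "x \<in> {c..d}"
  shows "(\<lambda>n. prefix_map g \<omega> n x) \<longlonglongrightarrow> coding_map c d g \<omega>"
proof -
  have "A \<noteq> {}" using \<omega> by (auto simp: space_shift_space)
  note lim = ratio_power_tendsto[OF this]
  have "(\<lambda>n. dist (prefix_map g \<omega> n x) (coding_map c d g \<omega>)) \<longlonglongrightarrow> 0"
    using prefix_map_diameter[OF \<omega> _ coding_map_mem[OF \<omega>]] x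
    by (intro tendsto_sandwich[OF _ _ tendsto_const lim]) auto
  then show ?thesis by (rule tendsto_dist_iff[THEN iffD2])
qed

end

lemma continuous_on_interval_bounded:
  fixes F :: "real \<Rightarrow> real"
  assumes "continuous_on {c..d} F"
  shows "\<exists>B. \<forall>y\<in>{c..d}. \<bar>F y\<bar> \<le> B"
proof -
  have "bounded (F ` {c..d})"
    by (intro compact_imp_bounded compact_continuous_image assms) simp
  then show ?thesis by (simp add: bounded_real)
qed

text \<open>The value depends on the first \<open>n\<close> letters only, so it takes finitely many values and is
  measurable for arbitrary maps \<open>F\<close> and \<open>g a\<close>; the generality in \<open>F\<close> is what the induction uses.\<close>

lemma prefix_map_measurable:
  fixes F :: "real \<Rightarrow> real"
  assumes A: "finite A"
  shows "(\<lambda>\<omega>. F (prefix_map g \<omega> n x)) \<in> borel_measurable (shift_space A)"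
proof (induction n arbitrary: F)
  case (Suc n)
  have "(\<lambda>\<omega>. (F \<circ> g (\<omega> 0)) (prefix_map g (shift \<omega>) n x)) \<in> borel_measurable (shift_space A)"
  proof (rule measurable_compose_countable'[where g = "\<lambda>\<omega>. \<omega> 0" and I = A
        and f = "\<lambda>a \<omega>. (F \<circ> g a) (prefix_map g (shift \<omega>) n x)"])
    show "(\<lambda>\<omega>. (F \<circ> g a) (prefix_map g (shift \<omega>) n x)) \<in> borel_measurable (shift_space A)"
      if "a \<in> A" for a
      by (rule measurable_compose[OF shift_measurable Suc])
  qed (use A coordinate_measurable in \<open>auto simp: countable_finite\<close>)
  then show ?case by (simp only: prefix_map_Suc_shift comp_apply)
qed simp

lemma (in contracting_system) coding_map_measurable:
  assumes A: "finite A"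
  shows "coding_map c d g \<in> borel_measurable (shift_space A)"
proof (rule borel_measurable_LIMSEQ_real)
  show "(\<lambda>n. prefix_map g \<omega> n c) \<longlonglongrightarrow> coding_map c d g \<omega>" if "\<omega> \<in> space (shift_space A)" for \<omega>
    using prefix_map_tendsto_coding_map[OF that] c_le_d by simp
  show "(\<lambda>\<omega>. prefix_map g \<omega> n c) \<in> borel_measurable (shift_space A)" for n
    by (rule prefix_map_measurable[OF A, where F = "\<lambda>y. y"])
qed

text \<open>Lebesgue measure on \<open>{c..d}\<close> equals the average of its images under the maps of the system, as
  tested by continuous functions.\<close>

definition lebesgue_stationary :: "real \<Rightarrow> real \<Rightarrow> 'a set \<Rightarrow> ('a \<Rightarrow> real \<Rightarrow> real) \<Rightarrow> bool" where
  "lebesgue_stationary c d A g \<longleftrightarrow> (\<forall>F :: real \<Rightarrow> real. continuous_on {c..d} F \<longrightarrow>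
     (\<Sum>a\<in>A. integral {c..d} (\<lambda>x. F (g a x))) = real (card A) * integral {c..d} F)"

text \<open>The \<open>n\<close>-th power of the averaging operator of the system, applied to \<open>F\<close>.\<close>

definition mean_after :: "'a set \<Rightarrow> ('a \<Rightarrow> real \<Rightarrow> real) \<Rightarrow> nat \<Rightarrow> (real \<Rightarrow> real) \<Rightarrow> real \<Rightarrow> real" where
  "mean_after A g n F x = (\<integral>\<omega>. F (prefix_map g \<omega> n x) \<partial>uniform_bernoulli A)"

context contracting_system
begin

context
  assumes A: "finite A" "A \<noteq> {}"
begin

lemma mean_after_0: "mean_after A g 0 F x = F x"
  using prob_space_uniform_bernoulli[OF A] by (simp add: mean_after_def prob_space.prob_space)

lemma mean_after_Suc:
  assumes F: "continuous_on {c..d} F" and x: "x \<in> {c..d}"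
  shows "mean_after A g (Suc n) F x = (\<Sum>a\<in>A. mean_after A g n (\<lambda>y. F (g a y)) x) / real (card A)"
proof -
  obtain B where B: "\<forall>y\<in>{c..d}. \<bar>F y\<bar> \<le> B"
    using continuous_on_interval_bounded[OF F] ..
  have shift_cons: "shift (case_nat a \<omega>) = \<omega>" for a and \<omega> :: "nat \<Rightarrow> 'a"
    by (simp add: shift_def)
  have "(\<integral>\<omega>. F (prefix_map g \<omega> (Suc n) x) \<partial>uniform_bernoulli A)
      = (\<Sum>a\<in>A. \<integral>\<omega>. F (prefix_map g (case_nat a \<omega>) (Suc n) x) \<partial>uniform_bernoulli A) / real (card A)"
  proof (rule integral_uniform_bernoulli_first[OF A, where B = B
        and f = "\<lambda>\<omega>. F (prefix_map g \<omega> (Suc n) x)"])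
    show "(\<lambda>\<omega>. F (prefix_map g \<omega> (Suc n) x)) \<in> borel_measurable (shift_space A)"
      by (rule prefix_map_measurable[OF A(1)])
    show "\<bar>F (prefix_map g \<omega> (Suc n) x)\<bar> \<le> B" if "\<omega> \<in> space (shift_space A)" for \<omega>
      by (rule B[rule_format, OF prefix_map_mem[OF that x]])
  qed
  also have "\<dots> = (\<Sum>a\<in>A. \<integral>\<omega>. F (g a (prefix_map g \<omega> n x)) \<partial>uniform_bernoulli A) / real (card A)"
    by (simp only: prefix_map_Suc_shift comp_apply shift_cons nat.case)
  finally show ?thesis by (simp only: mean_after_def)
qed

lemma continuous_on_map_comp:
  assumes F: "continuous_on {c..d} F" and a: "a \<in> A"
  shows "continuous_on {c..d} (\<lambda>y. F (g a y))"
  using maps_into[OF a]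
  by (rule continuous_on_compose2[OF F lipschitz_on_continuous_on[OF contracting[OF a]]])

lemma continuous_on_mean_after:
  "continuous_on {c..d} F \<Longrightarrow> continuous_on {c..d} (mean_after A g n F)"
proof (induction n arbitrary: F)
  case 0
  then show ?case by (simp add: mean_after_0[abs_def])
next
  case (Suc n)
  have "continuous_on {c..d} (\<lambda>x. (\<Sum>a\<in>A. mean_after A g n (\<lambda>y. F (g a y)) x) / real (card A))"
    using A by (intro continuous_intros Suc.IH continuous_on_map_comp[OF Suc.prems]) auto
  then show ?case
    by (rule continuous_on_eq) (simp add: mean_after_Suc[OF Suc.prems])
qed

text \<open>Long compositions forget their starting point, so the limit does not depend on \<open>x\<close>.\<close>

lemma mean_after_tendsto:
  assumes F: "continuous_on {c..d} F" and x: "x \<in> {c..d}"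
  shows "(\<lambda>n. mean_after A g n F x) \<longlonglongrightarrow> (\<integral>\<omega>. F (coding_map c d g \<omega>) \<partial>uniform_bernoulli A)"
proof -
  interpret prob_space "uniform_bernoulli A" by (rule prob_space_uniform_bernoulli[OF A])
  obtain B where B: "\<forall>y\<in>{c..d}. \<bar>F y\<bar> \<le> B"
    using continuous_on_interval_bounded[OF F] ..
  have lim: "(\<lambda>n. F (prefix_map g \<omega> n x)) \<longlonglongrightarrow> F (coding_map c d g \<omega>)"
    if \<omega>: "\<omega> \<in> space (shift_space A)" for \<omega>
    using continuous_on_tendsto_compose[OF F prefix_map_tendsto_coding_map[OF \<omega> x]
        coding_map_in_interval[OF \<omega>]] prefix_map_mem[OF \<omega> x] by simp
  have meas: "(\<lambda>\<omega>. F (prefix_map g \<omega> n x)) \<in> borel_measurable (uniform_bernoulli A)" for n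
    unfolding measurable_uniform_bernoulli by (rule prefix_map_measurable[OF A(1)])
  show ?thesis
    unfolding mean_after_def
  proof (rule integral_dominated_convergence[where w = "\<lambda>_. B"])
    show "(\<lambda>\<omega>. F (coding_map c d g \<omega>)) \<in> borel_measurable (uniform_bernoulli A)"
      by (rule borel_measurable_LIMSEQ_real[OF _ meas]) (rule lim, simp add: space_uniform_bernoulli)
    show "AE \<omega> in uniform_bernoulli A.
        (\<lambda>n. F (prefix_map g \<omega> n x)) \<longlonglongrightarrow> F (coding_map c d g \<omega>)"
      using lim by (intro AE_I2) (simp add: space_uniform_bernoulli)
    show "AE \<omega> in uniform_bernoulli A. norm (F (prefix_map g \<omega> n x)) \<le> B" for n
      using B[rule_format, OF prefix_map_mem[OF _ x]] by (intro AE_I2) (simp add: space_uniform_bernoulli)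
  qed (rule meas, simp)
qed

lemma integral_mean_after:
  assumes stationary: "lebesgue_stationary c d A g"
    and F: "continuous_on {c..d} F"
  shows "integral {c..d} (mean_after A g n F) = integral {c..d} F"
  using F
proof (induction n arbitrary: F)
  case 0
  then show ?case by (simp add: mean_after_0[abs_def])
next
  case (Suc n)
  note cont = continuous_on_map_comp[OF Suc.prems]
  have "integral {c..d} (mean_after A g (Suc n) F)
      = integral {c..d} (\<lambda>x. (\<Sum>a\<in>A. mean_after A g n (\<lambda>y. F (g a y)) x) / real (card A))"
    by (intro integral_cong mean_after_Suc Suc.prems)
  also have "\<dots> = (\<Sum>a\<in>A. integral {c..d} (mean_after A g n (\<lambda>y. F (g a y)))) / real (card A)"
    using A cont by (subst integral_divide, subst integral_sum)
      (auto intro!: integrable_continuous_interval continuous_on_mean_after)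
  also have "\<dots> = (\<Sum>a\<in>A. integral {c..d} (\<lambda>y. F (g a y))) / real (card A)"
    using Suc.IH[OF cont] by simp
  also have "\<dots> = integral {c..d} F"
    using stationary Suc.prems A by (simp add: lebesgue_stationary_def card_gt_0_iff)
  finally show ?case .
qed

text \<open>The law of the coding map is the only stationary measure, hence normalised Lebesgue measure if
  the latter is stationary: the integral over the starting point of the \<open>n\<close>-step mean is
  constant in \<open>n\<close>, while the means converge to a constant function of the starting point.\<close>

lemma integral_coding_map:
  assumes stationary: "lebesgue_stationary c d A g"
    and F: "continuous_on {c..d} F"
  shows "(d - c) * (\<integral>\<omega>. F (coding_map c d g \<omega>) \<partial>uniform_bernoulli A) = integral {c..d} F"
proof -
  interpret prob_space "uniform_bernoulli A" by (rule prob_space_uniform_bernoulli[OF A])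
  let ?I = "\<integral>\<omega>. F (coding_map c d g \<omega>) \<partial>uniform_bernoulli A"
  obtain B where B: "\<forall>y\<in>{c..d}. \<bar>F y\<bar> \<le> B"
    using continuous_on_interval_bounded[OF F] ..
  have "(\<lambda>n. integral {c..d} (mean_after A g n F)) \<longlonglongrightarrow> integral {c..d} (\<lambda>_. ?I)"
  proof (rule dominated_convergence(2)[where h = "\<lambda>_. B"])
    show "mean_after A g n F integrable_on {c..d}" for n
      by (intro integrable_continuous_interval continuous_on_mean_after F)
    show "norm (mean_after A g n F x) \<le> B" if "x \<in> {c..d}" for n x
    proof -
      have bound: "\<bar>F (prefix_map g \<omega> n x)\<bar> \<le> B" if "\<omega> \<in> space (shift_space A)" for \<omega>
        by (rule B[rule_format, OF prefix_map_mem[OF that \<open>x \<in> {c..d}\<close>]])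
      have "(\<lambda>\<omega>. F (prefix_map g \<omega> n x)) \<in> borel_measurable (uniform_bernoulli A)"
        unfolding measurable_uniform_bernoulli by (rule prefix_map_measurable[OF A(1)])
      then have int: "integrable (uniform_bernoulli A) (\<lambda>\<omega>. F (prefix_map g \<omega> n x))"
        using bound by (intro integrable_const_bound[of _ B] AE_I2) (auto simp: space_uniform_bernoulli)
      have "norm (mean_after A g n F x) \<le> (\<integral>\<omega>. norm (F (prefix_map g \<omega> n x)) \<partial>uniform_bernoulli A)"
        unfolding mean_after_def by (rule integral_norm_bound)
      also have "\<dots> \<le> B"
        using bound by (intro integral_le_const integrable_norm int AE_I2)
          (simp add: space_uniform_bernoulli)
      finally show ?thesis .
    qed
  qed (use mean_after_tendsto[OF F] in auto)
  moreover have "(\<lambda>n. integral {c..d} (mean_after A g n F)) = (\<lambda>n. integral {c..d} F)"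
    using integral_mean_after[OF stationary F] by simp
  ultimately have "integral {c..d} F = integral {c..d} (\<lambda>_. ?I)"
    by (simp add: LIMSEQ_const_iff)
  then show ?thesis using c_le_d by simp
qed

end

end


section \<open>An obstruction to linearisation\<close>

text \<open>On an interval a map with constant derivative is affine, hence determined by its values at the two
  endpoints. Two maps of the system that agree at both endpoints would have linearisations that
  agree at both endpoints, thus everywhere, and injectivity of the conjugacy makes the maps equal.\<close>

lemma not_C1_conjugate_to_linear:
  assumes "c < d" and a: "a \<in> A" and b: "b \<in> A"
    and into: "g a ` {c..d} \<subseteq> {c..d}" "g b ` {c..d} \<subseteq> {c..d}"
    and ends: "g a c = g b c" "g a d = g b d"
    and x: "x \<in> {c..d}" "g a x \<noteq> g b x"
  shows "\<not> C1_conjugate_to_linear c d A g"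
proof
  assume "C1_conjugate_to_linear c d A g"
  then obtain h where h: "C1_diffeo_on {c..d} h"
    and lin: "\<And>e. e \<in> A \<Longrightarrow> \<exists>r. \<forall>y \<in> h ` {c..d}.
      (h \<circ> g e \<circ> the_inv_into {c..d} h has_real_derivative r) (at y within h ` {c..d})"
    unfolding C1_conjugate_to_linear_def by blast
  have inj: "inj_on h {c..d}" using h by (simp add: C1_diffeo_on_def)
  have "continuous_on {c..d} h"
    using h unfolding C1_diffeo_on_def C1_on_def by (blast intro: DERIV_continuous_on)
  then have "connected (h ` {c..d})" by (intro connected_continuous_image) auto
  then have conv: "convex (h ` {c..d})"
    by (simp add: is_interval_connected_1 flip: is_interval_convex_1)
  have affine: "\<exists>r k. \<forall>z\<in>{c..d}. h (g e z) = r * h z + k" if "e \<in> A" for e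
  proof -
    obtain r where r: "\<And>y. y \<in> h ` {c..d} \<Longrightarrow>
        (h \<circ> g e \<circ> the_inv_into {c..d} h has_real_derivative r) (at y within h ` {c..d})"
      using lin[OF \<open>e \<in> A\<close>] by blast
    have "((\<lambda>y. (h \<circ> g e \<circ> the_inv_into {c..d} h) y - r * y) has_real_derivative 0)
        (at y within h ` {c..d})" if "y \<in> h ` {c..d}" for y
      using DERIV_diff[OF r[OF that] DERIV_cmult_Id[of r]] by simp
    from has_field_derivative_zero_constant[OF conv this]
    obtain k where k: "\<And>y. y \<in> h ` {c..d} \<Longrightarrow> (h \<circ> g e \<circ> the_inv_into {c..d} h) y - r * y = k"
      by blast
    have "h (g e z) = r * h z + k" if "z \<in> {c..d}" for z
      using k[of "h z"] that by (simp add: the_inv_into_f_f[OF inj])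
    then show ?thesis by blast
  qed
  obtain r k where r: "\<And>z. z \<in> {c..d} \<Longrightarrow> h (g a z) = r * h z + k"
    using affine[OF a] by blast
  obtain s l where s: "\<And>z. z \<in> {c..d} \<Longrightarrow> h (g b z) = s * h z + l"
    using affine[OF b] by blast
  have "r * h c + k = s * h c + l" "r * h d + k = s * h d + l"
    using r[of c] s[of c] r[of d] s[of d] ends \<open>c < d\<close> by simp_all
  then have "(r - s) * (h c - h d) = 0" "l = k + (r - s) * h c"
    by (simp_all add: algebra_simps)
  moreover have "h c \<noteq> h d" using inj \<open>c < d\<close> by (auto dest: inj_onD)
  ultimately have "r = s" "k = l" by auto
  then have "h (g a x) = h (g b x)" using r[OF x(1)] s[OF x(1)] by simp
  moreover have "g a x \<in> {c..d}" "g b x \<in> {c..d}" using into x(1) by blast+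
  ultimately show False using inj x(2) by (auto dest: inj_onD)
qed

section \<open>Fourier decay of Lebesgue measure\<close>

text \<open>Over the unit interval the oscillating integrands have explicit primitives, each with a factor
  \<open>1 / (2 * pi * \<xi>)\<close>.\<close>

lemma power_fourier_decay_if_lebesgue:
  assumes "prob_space \<mu>" and sets: "sets \<mu> = sets borel"
    and leb: "\<And>F::real \<Rightarrow> real. continuous_on UNIV F \<Longrightarrow> (\<integral>x. F x \<partial>\<mu>) = integral {0..1} F"
  shows "power_fourier_decay \<mu>"
proof -
  interpret prob_space \<mu> by fact
  have "norm (fourier_transform \<mu> \<xi>) \<le> 1 * \<bar>\<xi>\<bar> powr (- 1)" if \<xi>: "\<xi> \<noteq> 0" for \<xi>
  proof -
    define t where "t = 2 * pi * \<xi>"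
    have t: "t \<noteq> 0" using \<xi> by (simp add: t_def)
    let ?e = "\<lambda>x. exp (- 2 * of_real pi * \<i> * of_real \<xi> * of_real x) :: complex"
    have e: "?e x = cis (- (t * x))" for x
      by (simp add: cis_conv_exp t_def mult_ac)
    have int: "integrable \<mu> ?e"
    proof (rule integrable_const_bound[of _ 1])
      show "AE x in \<mu>. norm (?e x) \<le> 1" unfolding e by (intro AE_I2) simp
      have "?e \<in> borel_measurable borel"
        by (intro borel_measurable_continuous_onI continuous_intros)
      then show "?e \<in> borel_measurable \<mu>" by (simp add: measurable_cong_sets[OF sets refl])
    qed
    have Re: "Re (fourier_transform \<mu> \<xi>) = sin t / t"
    proof -
      have "Re (fourier_transform \<mu> \<xi>) = (\<integral>x. cos (t * x) \<partial>\<mu>)"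
        using integral_Re[OF int] unfolding fourier_transform_def e by simp
      also have "\<dots> = integral {0..1} (\<lambda>x. cos (t * x))"
        by (intro leb continuous_intros)
      also have "((\<lambda>x. cos (t * x)) has_integral sin (t * 1) / t - sin (t * 0) / t) {0..1}"
        using t by (intro fundamental_theorem_of_calculus)
          (auto intro!: derivative_eq_intros simp flip: has_real_derivative_iff_has_vector_derivative)
      then have "integral {0..1} (\<lambda>x. cos (t * x)) = sin t / t" by (simp add: integral_unique)
      finally show ?thesis .
    qed
    have Im: "Im (fourier_transform \<mu> \<xi>) = (cos t - 1) / t"
    proof -
      have "Im (fourier_transform \<mu> \<xi>) = (\<integral>x. - sin (t * x) \<partial>\<mu>)"
        using integral_Im[OF int] unfolding fourier_transform_def e by simp
      also have "\<dots> = integral {0..1} (\<lambda>x. - sin (t * x))"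
        by (intro leb continuous_intros)
      also have "((\<lambda>x. - sin (t * x)) has_integral cos (t * 1) / t - cos (t * 0) / t) {0..1}"
        using t by (intro fundamental_theorem_of_calculus)
          (auto intro!: derivative_eq_intros simp flip: has_real_derivative_iff_has_vector_derivative)
      then have "integral {0..1} (\<lambda>x. - sin (t * x)) = (cos t - 1) / t"
        unfolding diff_divide_distrib by (intro integral_unique) simp
      finally show ?thesis .
    qed
    have "norm (fourier_transform \<mu> \<xi>) \<le> \<bar>sin t / t\<bar> + \<bar>(cos t - 1) / t\<bar>"
      using cmod_le[of "fourier_transform \<mu> \<xi>"] by (simp only: Re Im)
    also have "\<dots> \<le> 1 / \<bar>t\<bar> + 2 / \<bar>t\<bar>"
      using abs_sin_le_one[of t] abs_cos_le_one[of t] unfolding abs_divide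
      by (intro add_mono divide_right_mono) linarith+
    \<comment> \<open>The left-hand side is \<open>3 / (2 * pi)\<close> times the right-hand side, and \<open>pi > 3\<close>.\<close>
    also have "\<dots> \<le> 1 / \<bar>\<xi>\<bar>"
      using \<xi> pi_gt3 by (simp add: t_def abs_mult divide_simps)
    finally show ?thesis by (simp add: powr_minus_divide)
  qed
  then show ?thesis unfolding power_fourier_decay_def by (intro exI[of _ 1]) auto
qed

section \<open>A nonlinear system with stationary Lebesgue measure\<close>

lemma C1_holder_diffeo_onI:
  assumes inv: "\<And>x. x \<in> S \<Longrightarrow> k (f x) = x"
    and "C1_holder_on \<alpha> S f" "C1_holder_on \<alpha> (f ` S) k"
  shows "C1_holder_diffeo_on \<alpha> S f"
proof -
  have inj: "inj_on f S" by (rule inj_on_inverseI[of S k]) (rule inv)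
  have eq: "the_inv_into S f y = k y" if "y \<in> f ` S" for y
    using that by (auto simp: the_inv_into_f_f[OF inj] inv)
  have "C1_holder_on \<alpha> (f ` S) (the_inv_into S f)"
  proof -
    obtain k' K where D: "\<forall>y\<in>f ` S. (k has_real_derivative k' y) (at y within f ` S)"
      and H: "\<forall>x\<in>f ` S. \<forall>y\<in>f ` S. \<bar>k' x - k' y\<bar> \<le> K * \<bar>x - y\<bar> powr \<alpha>"
      using assms(3) unfolding C1_holder_on_def by (elim exE conjE)
    have "(the_inv_into S f has_real_derivative k' y) (at y within f ` S)" if "y \<in> f ` S" for y
      using D[rule_format, OF that] zero_less_one that
      by (rule has_field_derivative_transform_within) (simp add: eq)
    then show ?thesis
      unfolding C1_holder_on_def by (intro exI[of _ k'] exI[of _ K] conjI H ballI)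
  qed
  with inj assms(2) show ?thesis by (simp add: C1_holder_diffeo_on_def)
qed

text \<open>The inverse of \<open>u \<mapsto> 3/2 u + u\<^sup>2\<close>, which maps \<open>{0..1/2}\<close> onto \<open>{0..1}\<close> with derivative between
  \<open>3/2\<close> and \<open>5/2\<close>.\<close>

definition root_branch :: "real \<Rightarrow> real" where
  "root_branch x = sqrt (9 / 16 + x) - 3 / 4"

definition offset :: "nat \<Rightarrow> real" where
  "offset a = (if a < 2 then 0 else 1 / 2)"

text \<open>Even letters use \<open>root_branch\<close>; odd letters use its conjugate under reflection of both intervals,
  \<open>x \<mapsto> 1 - x\<close> and \<open>y \<mapsto> 1/2 - y\<close>, which has the same endpoint values. Letters \<open>0, 1\<close> map onto
  the left half of the unit interval and letters \<open>2, 3\<close> onto the right half.\<close>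

definition branches :: "nat \<Rightarrow> real \<Rightarrow> real" where
  "branches a x = offset a + (if even a then root_branch x else 1 / 2 - root_branch (1 - x))"

definition expansion :: "nat \<Rightarrow> real \<Rightarrow> real" where
  "expansion a y = (let u = y - offset a in if even a then 3 / 2 * u + u\<^sup>2 else 5 / 2 * u - u\<^sup>2)"

definition expansion_deriv :: "nat \<Rightarrow> real \<Rightarrow> real" where
  "expansion_deriv a y = (let u = y - offset a in if even a then 3 / 2 + 2 * u else 5 / 2 - 2 * u)"

lemma root_branch_inverse:
  "0 \<le> u \<Longrightarrow> root_branch (3 / 2 * u + u\<^sup>2) = u"
  "0 \<le> x \<Longrightarrow> 3 / 2 * root_branch x + (root_branch x)\<^sup>2 = x"
proof -
  show "root_branch (3 / 2 * u + u\<^sup>2) = u" if "0 \<le> u"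
  proof -
    have "9 / 16 + (3 / 2 * u + u\<^sup>2) = (u + 3 / 4)\<^sup>2" by (simp add: power2_eq_square algebra_simps)
    then show ?thesis using that by (simp add: root_branch_def)
  qed
  show "3 / 2 * root_branch x + (root_branch x)\<^sup>2 = x" if "0 \<le> x"
  proof -
    have "3 / 2 * root_branch x + (root_branch x)\<^sup>2 = (sqrt (9 / 16 + x))\<^sup>2 - 9 / 16"
      by (simp add: root_branch_def power2_eq_square algebra_simps)
    then show ?thesis using that by simp
  qed
qed

lemma root_branch_ends: "root_branch 0 = 0" "root_branch 1 = 1 / 2"
  using root_branch_inverse(1)[of 0] root_branch_inverse(1)[of "1/2"] by (simp_all add: power2_eq_square)

lemma root_branch_range:
  assumes "x \<in> {0..1}" shows "root_branch x \<in> {0..1/2}"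
proof -
  have "root_branch 0 \<le> root_branch x" "root_branch x \<le> root_branch 1"
    using assms by (auto simp: root_branch_def)
  then show ?thesis by (simp add: root_branch_ends)
qed

lemma sqrt_shift_ge: "0 \<le> x \<Longrightarrow> 3 / 4 \<le> sqrt (9 / 16 + x)"
  by (rule real_le_rsqrt) (simp add: power2_eq_square)

lemma sqrt_shift_lipschitz:
  assumes "0 \<le> x" "0 \<le> y"
  shows "\<bar>sqrt (9 / 16 + x) - sqrt (9 / 16 + y)\<bar> \<le> 2 / 3 * \<bar>x - y\<bar>"
proof -
  let ?u = "sqrt (9 / 16 + x)" and ?v = "sqrt (9 / 16 + y)"
  have "3 / 4 \<le> ?u" "3 / 4 \<le> ?v" by (rule sqrt_shift_ge, fact)+
  then have "\<bar>?u - ?v\<bar> * (3 / 2) \<le> \<bar>?u - ?v\<bar> * \<bar>?u + ?v\<bar>"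
    by (intro mult_left_mono) auto
  also have "\<dots> = \<bar>?u\<^sup>2 - ?v\<^sup>2\<bar>"
    by (simp add: power2_eq_square algebra_simps flip: abs_mult)
  also have "\<dots> = \<bar>x - y\<bar>" using assms by simp
  finally show ?thesis by simp
qed

lemma root_branch_lipschitz:
  "0 \<le> x \<Longrightarrow> 0 \<le> y \<Longrightarrow> \<bar>root_branch x - root_branch y\<bar> \<le> 2 / 3 * \<bar>x - y\<bar>"
  using sqrt_shift_lipschitz[of x y] by (simp add: root_branch_def)

definition root_branch_deriv :: "real \<Rightarrow> real" where
  "root_branch_deriv x = 1 / (2 * sqrt (9 / 16 + x))"

lemma root_branch_has_derivative:
  "0 \<le> x \<Longrightarrow> (root_branch has_real_derivative root_branch_deriv x) (at x within S)"
  unfolding root_branch_def[abs_def] root_branch_deriv_def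
  by (auto intro!: derivative_eq_intros simp: field_simps)

lemma root_branch_deriv_lipschitz:
  assumes "0 \<le> x" "0 \<le> y"
  shows "\<bar>root_branch_deriv x - root_branch_deriv y\<bar> \<le> \<bar>x - y\<bar>"
proof -
  let ?u = "sqrt (9 / 16 + x)" and ?v = "sqrt (9 / 16 + y)"
  have u: "3 / 4 \<le> ?u" and v: "3 / 4 \<le> ?v" by (rule sqrt_shift_ge, fact)+
  have uv: "3 / 4 * (3 / 4) \<le> ?u * ?v" using u v assms by (intro mult_mono) auto
  have diff_inverse: "1 / (2 * p) - 1 / (2 * q) = (q - p) / (2 * (p * q))" if "0 < p" "0 < q" for p q :: real
    using that by (simp add: field_simps)
  have "root_branch_deriv x - root_branch_deriv y = (?v - ?u) / (2 * (?u * ?v))"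
    unfolding root_branch_deriv_def using u v by (intro diff_inverse) linarith+
  then have "\<bar>root_branch_deriv x - root_branch_deriv y\<bar> = \<bar>?u - ?v\<bar> / (2 * (?u * ?v))"
    using u v assms by (simp add: abs_mult abs_minus_commute)
  also have "\<dots> \<le> \<bar>?u - ?v\<bar> / 1" using uv by (intro divide_left_mono) auto
  also have "\<dots> \<le> \<bar>x - y\<bar>" using order_trans[OF sqrt_shift_lipschitz[OF assms], of "\<bar>x - y\<bar>"] by simp
  finally show ?thesis .
qed

lemma branches_range:
  assumes "x \<in> {0..1}" shows "branches a x \<in> {offset a..offset a + 1 / 2}"
  using root_branch_range[OF assms] root_branch_range[of "1 - x"] assms by (auto simp: branches_def)

lemma expansion_branches:
  assumes "x \<in> {0..1}" shows "expansion a (branches a x) = x"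
proof (cases "even a")
  case True
  then show ?thesis
    using root_branch_inverse(2)[of x] assms by (simp add: expansion_def branches_def)
next
  case False
  let ?v = "root_branch (1 - x)"
  have "5 / 2 * (1 / 2 - ?v) - (1 / 2 - ?v)\<^sup>2 = 1 - (3 / 2 * ?v + ?v\<^sup>2)"
    by (simp add: power2_eq_square algebra_simps)
  then show ?thesis
    using False root_branch_inverse(2)[of "1 - x"] assms by (simp add: expansion_def branches_def)
qed

lemma branches_expansion:
  assumes "y \<in> {offset a..offset a + 1 / 2}"
  shows "branches a (expansion a y) = y"
proof -
  define u where "u = y - offset a"
  have u: "0 \<le> u" "u \<le> 1 / 2" and y: "y = offset a + u" using assms by (auto simp: u_def)
  have "1 - (5 / 2 * u - u\<^sup>2) = 3 / 2 * (1 / 2 - u) + (1 / 2 - u)\<^sup>2"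
    by (simp add: power2_eq_square field_simps)
  then show ?thesis
    using root_branch_inverse(1)[of u] root_branch_inverse(1)[of "1 / 2 - u"] u
    by (simp add: y branches_def expansion_def)
qed

lemma expansion_ends: "expansion a (offset a) = 0" "expansion a (offset a + 1 / 2) = 1"
  by (simp_all add: expansion_def Let_def power2_eq_square)

lemma expansion_range:
  assumes "y \<in> {offset a..offset a + 1 / 2}" shows "expansion a y \<in> {0..1}"
proof -
  define u where "u = y - offset a"
  have u: "0 \<le> u" "u \<le> 1 / 2" and y: "y = offset a + u" using assms by (auto simp: u_def)
  have "u * u \<le> 1 / 2 * u" using u by (intro mult_right_mono) auto
  moreover have "0 \<le> (1 / 2 - u) * (1 / 2 - u)" "0 \<le> u * u" by simp_all
  ultimately show ?thesis using u by (auto simp: y expansion_def power2_eq_square algebra_simps)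
qed

lemma branches_image: "branches a ` {0..1} = {offset a..offset a + 1 / 2}"
proof
  show "branches a ` {0..1} \<subseteq> {offset a..offset a + 1 / 2}" using branches_range by blast
  show "{offset a..offset a + 1 / 2} \<subseteq> branches a ` {0..1}"
    using branches_expansion expansion_range by (metis imageI subsetI)
qed

lemma branches_into: "branches a ` {0..1} \<subseteq> {0..1}"
  unfolding branches_image by (auto simp: offset_def)

lemma expansion_has_derivative:
  "(expansion a has_real_derivative expansion_deriv a y) (at y within S)"
  unfolding expansion_def[abs_def] expansion_deriv_def Let_def
  by (cases "even a") (auto intro!: derivative_eq_intros simp: algebra_simps)

lemma branches_diffeo: "C1_holder_diffeo_on 1 {0..1} (branches a)"
proof (rule C1_holder_diffeo_onI)
  show "expansion a (branches a x) = x" if "x \<in> {0..1}" for x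
    by (rule expansion_branches[OF that])
  show "C1_holder_on 1 {0..1} (branches a)"
    unfolding C1_holder_on_def
  proof (intro exI conjI ballI)
    let ?b' = "\<lambda>x. if even a then root_branch_deriv x else root_branch_deriv (1 - x)"
    show "(branches a has_real_derivative ?b' x) (at x within {0..1})" if x: "x \<in> {0..1}" for x
    proof (cases "even a")
      case True
      have "((\<lambda>x. offset a + root_branch x) has_real_derivative 0 + root_branch_deriv x)
          (at x within {0..1})"
        using x by (intro DERIV_add DERIV_const root_branch_has_derivative) simp
      then show ?thesis using True by (simp add: branches_def[abs_def])
    next
      case False
      have "((\<lambda>x. 1 - x) has_real_derivative 0 - 1) (at x within {0..1})"
        by (intro DERIV_diff DERIV_const DERIV_ident)
      moreover have "(root_branch has_real_derivative root_branch_deriv (1 - x)) (at (1 - x))"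
        using x by (intro root_branch_has_derivative) simp
      ultimately have "((\<lambda>x. root_branch (1 - x)) has_real_derivative root_branch_deriv (1 - x) * (0 - 1))
          (at x within {0..1})"
        by (rule DERIV_chain')
      then have "((\<lambda>x. offset a + (1 / 2 - root_branch (1 - x))) has_real_derivative
          0 + (0 - root_branch_deriv (1 - x) * (0 - 1))) (at x within {0..1})"
        by (intro DERIV_add DERIV_diff DERIV_const)
      then show ?thesis using False by (simp add: branches_def[abs_def])
    qed
    show "\<bar>?b' x - ?b' y\<bar> \<le> 1 * \<bar>x - y\<bar> powr 1" if "x \<in> {0..1}" "y \<in> {0..1}" for x y
      using that root_branch_deriv_lipschitz[of x y] root_branch_deriv_lipschitz[of "1 - x" "1 - y"]
      by (cases "even a") (simp_all add: abs_minus_commute[of x y])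
  qed
  show "C1_holder_on 1 (branches a ` {0..1}) (expansion a)"
    unfolding C1_holder_on_def
  proof (intro exI conjI ballI)
    show "(expansion a has_real_derivative expansion_deriv a y) (at y within branches a ` {0..1})" for y
      by (rule expansion_has_derivative)
    show "\<bar>expansion_deriv a x - expansion_deriv a y\<bar> \<le> 2 * \<bar>x - y\<bar> powr 1" for x y
    proof -
      have "expansion_deriv a x - expansion_deriv a y = (if even a then 2 else - 2) * (x - y)"
        by (simp add: expansion_deriv_def Let_def algebra_simps)
      then show ?thesis by (simp add: abs_mult)
    qed
  qed
qed

lemma branches_lipschitz: "(2 / 3)-lipschitz_on {0..1} (branches a)"
proof (rule lipschitz_onI)
  fix x y :: real assume xy: "x \<in> {0..1}" "y \<in> {0..1}"
  show "dist (branches a x) (branches a y) \<le> 2 / 3 * dist x y"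
  proof (cases "even a")
    case True
    then show ?thesis
      using root_branch_lipschitz[of x y] xy by (simp add: branches_def dist_real_def)
  next
    case False
    then have "dist (branches a x) (branches a y) = \<bar>root_branch (1 - x) - root_branch (1 - y)\<bar>"
      by (simp add: branches_def dist_real_def)
    then show ?thesis
      using root_branch_lipschitz[of "1 - x" "1 - y"] xy by (simp add: dist_real_def abs_minus_commute[of x y])
  qed
qed simp

text \<open>The images of Lebesgue measure under two branches onto the same half interval have as densities the
  derivatives of the inverse branches. These are not constant, but reflection pairs
  \<open>3/2 + 2 u\<close> with \<open>5/2 - 2 u\<close>, and the sum is the constant \<open>4\<close>.\<close>

lemma branches_stationary_pair:
  fixes F :: "real \<Rightarrow> real"
  assumes F: "continuous_on {0..1} F" and ab: "even a" "odd b" "offset a = offset b"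
  shows "integral {0..1} (\<lambda>x. F (branches a x)) + integral {0..1} (\<lambda>x. F (branches b x))
    = 4 * integral {offset a..offset a + 1 / 2} F"
proof -
  have sub: "((\<lambda>y. expansion_deriv e y * F y) has_integral integral {0..1} (\<lambda>x. F (branches e x)))
      {offset e..offset e + 1 / 2}" for e
  proof -
    have "continuous_on {0..1} (\<lambda>x. F (branches e x))"
      using branches_into by (rule continuous_on_compose2[OF F
            lipschitz_on_continuous_on[OF branches_lipschitz]])
    from has_integral_substitution[OF _ _ _ this expansion_has_derivative,
        of "offset e" "offset e + 1 / 2" e]
    have "((\<lambda>y. expansion_deriv e y * F (branches e (expansion e y))) has_integral
        integral {0..1} (\<lambda>x. F (branches e x))) {offset e..offset e + 1 / 2}"
      using expansion_range[of _ e] by (simp add: expansion_ends image_subset_iff)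
    then show ?thesis
      by (rule has_integral_eq[rotated]) (simp add: branches_expansion)
  qed
  have "expansion_deriv a y + expansion_deriv b y = 4" for y
    using ab by (simp add: expansion_deriv_def)
  then have "(\<lambda>y. expansion_deriv a y * F y + expansion_deriv b y * F y) = (\<lambda>y. 4 * F y)"
    by (simp flip: distrib_right)
  with has_integral_add[OF sub[of a] sub[of b, folded ab(3)]]
  have "((\<lambda>y. 4 * F y) has_integral
      integral {0..1} (\<lambda>x. F (branches a x)) + integral {0..1} (\<lambda>x. F (branches b x)))
      {offset a..offset a + 1 / 2}" by simp
  then show ?thesis by (simp flip: integral_mult_right add: integral_unique)
qed

lemma branches_stationary:
  "lebesgue_stationary 0 1 {..<4} branches"
  unfolding lebesgue_stationary_def
proof (intro allI impI)
  fix F :: "real \<Rightarrow> real" assume F: "continuous_on {0..1} F"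
  let ?I = "\<lambda>a. integral {0..1} (\<lambda>x. F (branches a x))"
  have "(\<Sum>a<4. ?I a) = (?I 0 + ?I 1) + (?I 2 + ?I 3)"
    by (simp add: numeral_eq_Suc)
  also have "\<dots> = 4 * (integral {0..1 / 2} F + integral {1 / 2..1} F)"
    using branches_stationary_pair[OF F, of 0 1] branches_stationary_pair[OF F, of 2 3]
    by (simp add: offset_def)
  also have "integral {0..1 / 2} F + integral {1 / 2..1} F = integral {0..1} F"
    by (intro Henstock_Kurzweil_Integration.integral_combine integrable_continuous_interval F) auto
  finally show "(\<Sum>a<4. ?I a) = real (card {..<4 :: nat}) * integral {0..1} F" by simp
qed

interpretation branches: contracting_system 0 1 "{..<4}" branches "2 / 3"
  by unfold_locales (use branches_into branches_lipschitz in auto)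

text \<open>Equality would say that \<open>root_branch\<close> commutes with the reflections at the midpoint, that is
  \<open>root_branch (1 / 2) = 1 / 4\<close>; but \<open>3/2 u + u\<^sup>2\<close> is \<open>7/16\<close> at \<open>u = 1/4\<close>.\<close>

lemma root_branch_asymmetric: "root_branch (1 / 2) \<noteq> 1 / 2 - root_branch (1 / 2)"
proof
  assume "root_branch (1 / 2) = 1 / 2 - root_branch (1 / 2)"
  then have "root_branch (1 / 2) = 1 / 4" by simp
  with root_branch_inverse(2)[of "1 / 2"] show False by (simp add: power2_eq_square)
qed

theorem theorem1p6:
  "\<exists>(A :: nat set) (c :: real) (d :: real) (g :: nat \<Rightarrow> real \<Rightarrow> real) (\<alpha> :: real).
     0 < \<alpha> \<and> \<alpha> \<le> 1 \<and> C1_holder_ifs \<alpha> c d A g \<and>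
     (\<exists>F \<mu>. is_attractor c d A g F \<and> equilibrium_state c d A g \<mu> \<and>
        (AE x in \<mu>. x \<in> F) \<and> power_fourier_decay \<mu>) \<and>
     \<not> C1_conjugate_to_linear c d A g"
proof -
  let ?A = "{..<4} :: nat set"
  define \<mu> where "\<mu> = distr (uniform_bernoulli ?A) borel (coding_map 0 1 branches)"
  have A: "finite ?A" "?A \<noteq> {}" by (auto simp: lessThan_empty_iff)
  interpret prob_space "uniform_bernoulli ?A" by (rule prob_space_uniform_bernoulli[OF A])
  have meas: "coding_map 0 1 branches \<in> borel_measurable (uniform_bernoulli ?A)"
    unfolding measurable_uniform_bernoulli by (rule branches.coding_map_measurable[OF A(1)])
  have "C1_holder_ifs 1 0 1 ?A branches"
    unfolding C1_holder_ifs_def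
    by (intro conjI ballI exI[of _ "2 / 3"] A branches_into branches_diffeo branches_lipschitz) simp_all
  moreover have "is_attractor 0 1 ?A branches {0..1}"
  proof -
    have "{0..1 :: real} \<subseteq> {offset 0..offset 0 + 1 / 2} \<union> {offset 2..offset 2 + 1 / 2}"
      by (auto simp: offset_def)
    also have "\<dots> = branches 0 ` {0..1} \<union> branches 2 ` {0..1}" by (simp only: branches_image)
    also have "\<dots> \<subseteq> (\<Union>a\<in>?A. branches a ` {0..1})"
      by (intro Un_least UN_upper) simp_all
    finally have "{0..1} = (\<Union>a\<in>?A. branches a ` {0..1})"
      using branches_into by (intro equalityI UN_least)
    then show ?thesis by (simp add: is_attractor_def)
  qed
  moreover have "equilibrium_state 0 1 ?A branches \<mu>"
    unfolding equilibrium_state_def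
  proof (intro exI conjI)
    show "holder_potential ?A (\<lambda>_. 0)"
      unfolding holder_potential_def by (intro exI[of _ 0] exI[of _ "1 / 2"]) auto
  qed (use uniform_bernoulli_equilibrium[OF A] uniform_bernoulli_gibbs[OF A] \<mu>_def in auto)
  moreover have "AE x in \<mu>. x \<in> {0..1}"
    unfolding \<mu>_def using branches.coding_map_in_interval
    by (subst AE_distr_iff[OF meas]) (auto simp: space_uniform_bernoulli)
  moreover have "power_fourier_decay \<mu>"
  proof (rule power_fourier_decay_if_lebesgue)
    show "prob_space \<mu>" unfolding \<mu>_def by (rule prob_space_distr[OF meas])
    show "sets \<mu> = sets borel" by (simp add: \<mu>_def)
    fix F :: "real \<Rightarrow> real" assume F: "continuous_on UNIV F"
    have "(\<integral>x. F x \<partial>\<mu>) = (\<integral>\<omega>. F (coding_map 0 1 branches \<omega>) \<partial>uniform_bernoulli ?A)"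
      unfolding \<mu>_def by (rule integral_distr[OF meas borel_measurable_continuous_onI[OF F]])
    also have "\<dots> = integral {0..1} F"
      using branches.integral_coding_map[OF A branches_stationary continuous_on_subset[OF F subset_UNIV]]
      by simp
    finally show "(\<integral>x. F x \<partial>\<mu>) = integral {0..1} F" .
  qed
  moreover have "\<not> C1_conjugate_to_linear 0 1 ?A branches"
  proof (rule not_C1_conjugate_to_linear[of 0 1 0 _ 1 _ "1 / 2"])
    show "branches 0 (1 / 2) \<noteq> branches 1 (1 / 2)"
      using root_branch_asymmetric by (simp add: branches_def offset_def)
    show "branches 0 0 = branches 1 0" "branches 0 1 = branches 1 1"
      by (simp_all add: branches_def offset_def root_branch_ends)
  qed (use branches_into in auto)
  ultimately have "0 < (1 :: real) \<and> 1 \<le> (1 :: real) \<and> C1_holder_ifs 1 0 1 ?A branches \<and>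
     (\<exists>F \<mu>. is_attractor 0 1 ?A branches F \<and> equilibrium_state 0 1 ?A branches \<mu> \<and>
        (AE x in \<mu>. x \<in> F) \<and> power_fourier_decay \<mu>) \<and>
     \<not> C1_conjugate_to_linear 0 1 ?A branches"
    by (intro conjI exI[of _ "{0..1}"] exI[of _ \<mu>]) simp_all
  then show ?thesis by (intro exI)
qed

end
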